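(* Let $\{X_\lambda : \lambda\in\Lambda\}$ be a nonempty family of spaces with enough arcs. If their product $X=\prod_{\lambda\in\Lambda}X_\lambda$ (with the product topology) is metrizable, then $X$ is a space with enough arcs.
   Context: An arc is a homeomorphic copy of $[0,1]$. A space with enough arcs is a metrizable space $X$ with at least two points such that for every nonempty proper closed subset $A\subseteq X$ there is an arc in $X$ with one endpoint in $A$ and the other endpoint in $X\setminus A$. *)

theory Defs
  imports "HOL-Analysis.Analysis"
begin

(* The endpoints are ordered by the choice of the homeomorphism h; reversing it
   (t to 1 - t) exchanges a and b, so the order carries no information. *)
definition arc_with_endpoints :: "'a topology \<Rightarrow> 'a set \<Rightarrow> 'a \<Rightarrow> 'a \<Rightarrow> bool" where
  "arc_with_endpoints X C a b \<longleftrightarrow>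
     C \<subseteq> topspace X \<and>
     (\<exists>h. homeomorphic_map (top_of_set {0..1::real}) (subtopology X C) h \<and> h 0 = a \<and> h 1 = b)"

definition enough_arcs_space :: "'a topology \<Rightarrow> bool" where
  "enough_arcs_space X \<longleftrightarrow>
     metrizable_space X \<and>
     (\<exists>x \<in> topspace X. \<exists>y \<in> topspace X. x \<noteq> y) \<and>
     (\<forall>A. closedin X A \<and> A \<noteq> {} \<and> A \<noteq> topspace X \<longrightarrow>
        (\<exists>C. \<exists>a \<in> A. \<exists>b \<in> topspace X - A. arc_with_endpoints X C a b))"

end

theory Submission
  imports Defs
begin

text \<open>
  The arc in the product can be chosen so that only one coordinate moves along it. Call a slice
  the set of points obtained from a fixed point of the product by varying a single coordinate;
  it is an embedded copy of a factor. If \<open>A\<close> is closed, nonempty and proper, then some slice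
  contains both points of \<open>A\<close> and points outside \<open>A\<close> (\<open>closedin_product_splits_slice\<close>): otherwise
  membership in \<open>A\<close> would be unaffected by changing one coordinate, hence by changing finitely
  many, whereas the points that differ from a given one in finitely many coordinates are dense
  in the product, so that \<open>A\<close>, being closed, would be everything.

  The trace of \<open>A\<close> on such a slice is a nonempty proper closed subset of a copy of the factor.
  The factor supplies an arc across it, and the slice embedding
  (\<open>embedding_map_fun_upd\<close>, \<open>arc_with_endpoints_embedding_image\<close>) carries this arc into the product.
\<close>

lemma arc_with_endpoints_embedding_image:
  assumes "embedding_map X Y e" and "arc_with_endpoints X C a b"
  shows "arc_with_endpoints Y (e ` C) (e a) (e b)"
proof -
  obtain h where C: "C \<subseteq> topspace X"
    and h: "homeomorphic_map (top_of_set {0..1::real}) (subtopology X C) h"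
    and ends: "h 0 = a" "h 1 = b"
    using assms(2) unfolding arc_with_endpoints_def by blast
  have e: "homeomorphic_map X (subtopology Y (e ` topspace X)) e"
    using assms(1) by (simp add: embedding_map_def)
  have eY: "e ` topspace X \<subseteq> topspace Y"
    using homeomorphic_imp_surjective_map[OF e] unfolding topspace_subtopology by blast
  have "homeomorphic_map (subtopology X C)
      (subtopology (subtopology Y (e ` topspace X)) (e ` C)) e"
  proof (rule homeomorphic_map_subtopologies[OF e])
    show "e ` (topspace X \<inter> C) = topspace (subtopology Y (e ` topspace X)) \<inter> e ` C"
      using C eY by auto
  qed
  then have "homeomorphic_map (subtopology X C) (subtopology Y (e ` C)) e"
    using C by (simp add: subtopology_subtopology inf_absorb2 image_mono)
  then have "homeomorphic_map (top_of_set {0..1}) (subtopology Y (e ` C)) (e \<circ> h)"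
    using h homeomorphic_map_compose by blast
  moreover have "e ` C \<subseteq> topspace Y"
    using eY C by blast
  ultimately show ?thesis
    unfolding arc_with_endpoints_def using ends by force
qed

text \<open>The projection to the coordinate that varies is a continuous left inverse.\<close>

lemma embedding_map_fun_upd:
  assumes p: "p \<in> topspace (product_topology X I)" and l: "l \<in> I"
  shows "embedding_map (X l) (product_topology X I) (\<lambda>x. p(l := x))"
proof (rule section_imp_embedding_map)
  have "continuous_map (X l) (product_topology X I) (\<lambda>x. p(l := x))"
    unfolding continuous_map_componentwise
  proof (intro conjI ballI)
    show "(\<lambda>x. p(l := x)) ` topspace (X l) \<subseteq> extensional I"
      using p l by (auto simp: PiE_def extensional_def)
    fix k assume "k \<in> I"
    then show "continuous_map (X l) (X k) (\<lambda>x. (p(l := x)) k)"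
      using p by (cases "k = l") auto
  qed
  then show "section_map (X l) (product_topology X I) (\<lambda>x. p(l := x))"
    unfolding section_map_def retraction_maps_def
    using continuous_map_product_projection[OF l] by fastforce
qed

text \<open>
  If no slice met both \<open>A\<close> and its complement, one could start at a point of \<open>A\<close> and replace
  finitely many coordinates by those of a point outside \<open>A\<close> without leaving \<open>A\<close>; but a basic
  open neighbourhood of the latter point restricts only finitely many coordinates.
\<close>

lemma closedin_product_splits_slice:
  assumes A: "closedin (product_topology X I) A" "A \<noteq> {}" "A \<noteq> topspace (product_topology X I)"
  obtains l p x y where "l \<in> I" "p \<in> topspace (product_topology X I)"
    "x \<in> topspace (X l)" "y \<in> topspace (X l)" "p(l := x) \<in> A" "p(l := y) \<notin> A"
proof (rule ccontr)
  let ?P = "product_topology X I"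
  assume "\<not> thesis"
  with that have stay: "p(l := y) \<in> A"
    if "l \<in> I" "p \<in> topspace ?P" "x \<in> topspace (X l)" "y \<in> topspace (X l)" "p(l := x) \<in> A"
    for l p x y using that by blast
  have sub: "A \<subseteq> topspace ?P"
    using A closedin_subset by blast
  obtain a where a: "a \<in> A" using A by blast
  obtain b where b: "b \<in> topspace ?P - A" using A sub by blast
  have bi: "b i \<in> topspace (X i)" if "i \<in> I" for i
    using b that by (auto simp: PiE_iff)
  obtain U where fin: "finite {i \<in> I. U i \<noteq> topspace (X i)}"
    and bU: "b \<in> Pi\<^sub>E I U" and U: "Pi\<^sub>E I U \<subseteq> topspace ?P - A"
    using A(1) b unfolding closedin_def openin_product_topology_alt by meson
  have patch: "(\<lambda>i. if i \<in> F then b i else a i) \<in> A" if "finite F" "F \<subseteq> I" for F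
    using that
  proof (induction F rule: finite_induct)
    case empty
    then show ?case using a by simp
  next
    case (insert l F)
    let ?q = "\<lambda>i. if i \<in> F then b i else a i"
    have q: "?q \<in> A" and l: "l \<in> I" using insert by auto
    have q_top: "?q \<in> topspace ?P"
      by (rule subsetD[OF sub q])
    have "?q l \<in> topspace (X l)"
      by (rule PiE_mem[OF q_top[unfolded topspace_product_topology] l])
    then have "?q(l := b l) \<in> A"
    proof (rule stay[OF l q_top])
      show "b l \<in> topspace (X l)" by (rule bi[OF l])
      show "?q(l := ?q l) \<in> A" by (subst fun_upd_idem) (rule refl, rule q)
    qed
    moreover have "?q(l := b l) = (\<lambda>i. if i \<in> insert l F then b i else a i)"
      by auto
    ultimately show ?case by simp
  qed
  let ?c = "\<lambda>i. if i \<in> {i \<in> I. U i \<noteq> topspace (X i)} then b i else a i"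
  have "a \<in> topspace ?P" using a sub by blast
  then have "?c \<in> Pi\<^sub>E I U"
    using bU by (auto simp: PiE_iff extensional_def)
  moreover have "?c \<in> A"
    using patch[OF fin] by blast
  ultimately show False
    using U by blast
qed

theorem proposition19:
  fixes X :: "'i \<Rightarrow> 'a topology" and \<Lambda> :: "'i set"
  assumes "\<Lambda> \<noteq> {}"
    and "\<And>l. l \<in> \<Lambda> \<Longrightarrow> enough_arcs_space (X l)"
    and "metrizable_space (product_topology X \<Lambda>)"
  shows "enough_arcs_space (product_topology X \<Lambda>)"
proof -
  let ?P = "product_topology X \<Lambda>"
  have "\<exists>x \<in> topspace ?P. \<exists>y \<in> topspace ?P. x \<noteq> y"
  proof -
    obtain l where l: "l \<in> \<Lambda>" using assms(1) by blast
    obtain x y where xy: "x \<in> topspace (X l)" "y \<in> topspace (X l)" "x \<noteq> y"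
      using assms(2)[OF l] unfolding enough_arcs_space_def by blast
    have "\<forall>k\<in>\<Lambda>. topspace (X k) \<noteq> {}"
      using assms(2) unfolding enough_arcs_space_def by blast
    then obtain p where p: "p \<in> topspace ?P"
      by (metis PiE_eq_empty_iff all_not_in_conv topspace_product_topology)
    have "p(l := x) \<in> topspace ?P" "p(l := y) \<in> topspace ?P"
      using p l xy by (auto simp: PiE_iff extensional_def)
    moreover have "p(l := x) \<noteq> p(l := y)"
      using xy(3) by (metis fun_upd_same)
    ultimately show ?thesis by blast
  qed
  moreover have "\<exists>C. \<exists>a \<in> A. \<exists>b \<in> topspace ?P - A. arc_with_endpoints ?P C a b"
    if A: "closedin ?P A" "A \<noteq> {}" "A \<noteq> topspace ?P" for A
  proof -
    obtain l p x y where l: "l \<in> \<Lambda>" and p: "p \<in> topspace ?P"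
      and x: "x \<in> topspace (X l)" "p(l := x) \<in> A"
      and y: "y \<in> topspace (X l)" "p(l := y) \<notin> A"
      using closedin_product_splits_slice[OF A] by metis
    let ?e = "\<lambda>z. p(l := z)"
    let ?B = "{z \<in> topspace (X l). ?e z \<in> A}"
    have emb: "embedding_map (X l) ?P ?e"
      by (rule embedding_map_fun_upd[OF p l])
    then have cont: "continuous_map (X l) ?P ?e"
      unfolding embedding_map_def
      by (metis homeomorphic_imp_continuous_map continuous_map_in_subtopology)
    have "closedin (X l) ?B"
      by (rule closedin_continuous_map_preimage[OF cont A(1)])
    moreover have "?B \<noteq> {}" "?B \<noteq> topspace (X l)"
      using x y by blast+
    ultimately obtain C a b where C: "a \<in> ?B" "b \<in> topspace (X l) - ?B"
      "arc_with_endpoints (X l) C a b"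
      using assms(2)[OF l] unfolding enough_arcs_space_def by meson
    have "?e b \<in> topspace ?P - A"
      using C(2) continuous_map_image_subset_topspace[OF cont] by blast
    then show ?thesis
      using C(1) arc_with_endpoints_embedding_image[OF emb C(3)] by blast
  qed
  ultimately show ?thesis
    unfolding enough_arcs_space_def using assms(3) by blast
qed

end
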